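(* Let $G$ be a graph. Then there is a graph $H$ such that every vertex of $H$ edge-dominates at most one end of $\Omega(H)$ and such that the end space $\Omega(H)$ is homeomorphic to the edge-end space $\Omega_E(G)$.
   Context: Graphs are simple and undirected, of arbitrary cardinality. A ray is a one-way infinite path; its tails are its infinite connected subgraphs. A finite set $S\subset V(G)$ (resp. a finite set $F\subset E(G)$) separates two rays $r,s$ of $G$ if $r$ and $s$ have tails in different connected components of $G\setminus S$ (resp. of $G\setminus F$). Ends: for rays $r,s$ of $G$ write $r\sim s$ if no finite $S\subset V(G)$ separates them. This is an equivalence relation; the class of $r$ is the end $[r]$, and $\Omega(G)$ is the set of ends, with the topology whose basic open neighborhoods of $[r]$ are $\Omega(S,[r])=\{[s]\in\Omega(G): S \text{ does not separate } r \text{ and } s\}$ for finite $S\subset V(G)$. Edge-ends: write $r\sim_E s$ if no finite $F\subset E(G)$ separates them. This is an equivalence relation; the class of $r$ is the edge-end $[r]_E$, and $\Omega_E(G)$ is the set of edge-ends, with the topology whose basic open neighborhoods of $[r]_E$ are $\Omega_E(F,[r]_E)=\{[s]_E\in\Omega_E(G): F \text{ does not separate } r \text{ and } s\}$ for finite $F\subset E(G)$. A vertex $v$ edge-dominates a ray $r$ if for every finite set $F$ of edges, $v$ and a tail of $r$ belong to the same connected component after deleting $F$. A vertex $v$ edge-dominates an end $[r]$ (a class of $\sim$) if it edge-dominates $r$, equivalently every ray in $[r]$. *)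

theory Defs
  imports "HOL-Analysis.Analysis"
begin

record 'a ugraph =
  verts :: "'a set"
  edges :: "'a set set"

definition simple_graph :: "'a ugraph \<Rightarrow> bool" where
  "simple_graph G \<longleftrightarrow> (\<forall>e\<in>edges G. e \<subseteq> verts G \<and> card e = 2)"

definition del_verts :: "'a ugraph \<Rightarrow> 'a set \<Rightarrow> 'a ugraph" where
  "del_verts G S = \<lparr>verts = verts G - S, edges = {e \<in> edges G. e \<inter> S = {}}\<rparr>"

definition del_edges :: "'a ugraph \<Rightarrow> 'a set set \<Rightarrow> 'a ugraph" where
  "del_edges G F = \<lparr>verts = verts G, edges = edges G - F\<rparr>"

definition adj :: "'a ugraph \<Rightarrow> 'a \<Rightarrow> 'a \<Rightarrow> bool" where
  "adj G u v \<longleftrightarrow> {u, v} \<in> edges G"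

definition component_of_vert :: "'a ugraph \<Rightarrow> 'a \<Rightarrow> 'a set" where
  "component_of_vert G v = {w \<in> verts G. (adj G)\<^sup>*\<^sup>* v w}"

text \<open>Connected components are represented by their vertex sets.\<close>

definition graph_components :: "'a ugraph \<Rightarrow> 'a set set" where
  "graph_components G = component_of_vert G ` verts G"

text \<open>
  A ray is represented by the enumeration of its vertices from its starting vertex on, which
  is determined by the ray as a subgraph. The infinite connected subgraphs of a ray are
  exactly the paths obtained by deleting an initial segment.
\<close>

definition ray :: "'a ugraph \<Rightarrow> (nat \<Rightarrow> 'a) \<Rightarrow> bool" where
  "ray G r \<longleftrightarrow> inj r \<and> range r \<subseteq> verts G \<and> (\<forall>n. adj G (r n) (r (Suc n)))"

definition tail :: "nat \<Rightarrow> (nat \<Rightarrow> 'a) \<Rightarrow> nat \<Rightarrow> 'a" where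
  "tail n r = (\<lambda>i. r (n + i))"

definition has_tail_in :: "'a ugraph \<Rightarrow> (nat \<Rightarrow> 'a) \<Rightarrow> 'a set \<Rightarrow> bool" where
  "has_tail_in G r C \<longleftrightarrow> (\<exists>n. ray G (tail n r) \<and> range (tail n r) \<subseteq> C)"

definition tails_in_different_components ::
    "'a ugraph \<Rightarrow> (nat \<Rightarrow> 'a) \<Rightarrow> (nat \<Rightarrow> 'a) \<Rightarrow> bool" where
  "tails_in_different_components G r s \<longleftrightarrow>
     (\<exists>C\<in>graph_components G. \<exists>D\<in>graph_components G.
        C \<noteq> D \<and> has_tail_in G r C \<and> has_tail_in G s D)"

definition vert_separates :: "'a ugraph \<Rightarrow> 'a set \<Rightarrow> (nat \<Rightarrow> 'a) \<Rightarrow> (nat \<Rightarrow> 'a) \<Rightarrow> bool" where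
  "vert_separates G S r s \<longleftrightarrow> tails_in_different_components (del_verts G S) r s"

definition edge_separates :: "'a ugraph \<Rightarrow> 'a set set \<Rightarrow> (nat \<Rightarrow> 'a) \<Rightarrow> (nat \<Rightarrow> 'a) \<Rightarrow> bool" where
  "edge_separates G F r s \<longleftrightarrow> tails_in_different_components (del_edges G F) r s"

definition end_rel :: "'a ugraph \<Rightarrow> ((nat \<Rightarrow> 'a) \<times> (nat \<Rightarrow> 'a)) set" where
  "end_rel G = {(r, s). ray G r \<and> ray G s \<and>
     \<not> (\<exists>S. finite S \<and> S \<subseteq> verts G \<and> vert_separates G S r s)}"

definition edge_end_rel :: "'a ugraph \<Rightarrow> ((nat \<Rightarrow> 'a) \<times> (nat \<Rightarrow> 'a)) set" where
  "edge_end_rel G = {(r, s). ray G r \<and> ray G s \<and>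
     \<not> (\<exists>F. finite F \<and> F \<subseteq> edges G \<and> edge_separates G F r s)}"

definition ends :: "'a ugraph \<Rightarrow> (nat \<Rightarrow> 'a) set set" where
  "ends G = {r. ray G r} // end_rel G"

definition edge_ends :: "'a ugraph \<Rightarrow> (nat \<Rightarrow> 'a) set set" where
  "edge_ends G = {r. ray G r} // edge_end_rel G"

definition end_nbhd :: "'a ugraph \<Rightarrow> 'a set \<Rightarrow> (nat \<Rightarrow> 'a) \<Rightarrow> (nat \<Rightarrow> 'a) set set" where
  "end_nbhd G S r = {end_rel G `` {s} | s. ray G s \<and> \<not> vert_separates G S r s}"

definition edge_end_nbhd :: "'a ugraph \<Rightarrow> 'a set set \<Rightarrow> (nat \<Rightarrow> 'a) \<Rightarrow> (nat \<Rightarrow> 'a) set set" where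
  "edge_end_nbhd G F r = {edge_end_rel G `` {s} | s. ray G s \<and> \<not> edge_separates G F r s}"

text \<open>
  The generating families below are bases of the generated topologies, not merely subbases:
  a point of a basic set can replace the ray defining that set, and two basic sets around the
  same point contain the one for the union of the two finite sets.
\<close>

definition end_space :: "'a ugraph \<Rightarrow> (nat \<Rightarrow> 'a) set topology" where
  "end_space G = topology_generated_by
     {end_nbhd G S r | S r. finite S \<and> S \<subseteq> verts G \<and> ray G r}"

definition edge_end_space :: "'a ugraph \<Rightarrow> (nat \<Rightarrow> 'a) set topology" where
  "edge_end_space G = topology_generated_by
     {edge_end_nbhd G F r | F r. finite F \<and> F \<subseteq> edges G \<and> ray G r}"

definition edge_dominates :: "'a ugraph \<Rightarrow> 'a \<Rightarrow> (nat \<Rightarrow> 'a) \<Rightarrow> bool" where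
  "edge_dominates G v r \<longleftrightarrow>
     (\<forall>F. finite F \<and> F \<subseteq> edges G \<longrightarrow>
        (\<exists>C\<in>graph_components (del_edges G F). v \<in> C \<and> has_tail_in (del_edges G F) r C))"

definition edge_dominates_end :: "'a ugraph \<Rightarrow> 'a \<Rightarrow> (nat \<Rightarrow> 'a) set \<Rightarrow> bool" where
  "edge_dominates_end G v \<omega> \<longleftrightarrow> (\<exists>r\<in>\<omega>. edge_dominates G v r)"

end

theory Submission
  imports Defs
begin

text \<open>
  The graph \<open>H\<close> replaces every vertex \<open>v\<close> of \<open>G\<close> by a star whose centre is \<open>(v, v)\<close> and whose leaves are
  the half-edges \<open>(v, u)\<close> at \<open>v\<close>; the half-edges \<open>(v, u)\<close> and \<open>(u, v)\<close> are joined. If \<open>v\<close>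
  edge-dominates some ray, the star is completed to a clique. Deleting the half-edges of a finite
  edge set of \<open>G\<close> from \<open>H\<close> has the effect of deleting the edges from \<open>G\<close>. Conversely, deleting
  finitely many vertices of \<open>H\<close> amounts to deleting finitely many edges of \<open>G\<close>: the deletion of a centre
  is harmless in a clique, and in a star \<open>v\<close> can be separated from a given ray by
  finitely many edges. The projection of a ray of \<open>H\<close> that returns to \<open>v\<close> infinitely often
  can only do so through a clique, hence belongs to the unique edge-end that \<open>v\<close> edge-dominates;
  every other ray of \<open>H\<close> projects to a locally finite walk, which contains a ray.
\<close>

section \<open>Sequences with connected tails\<close>

text \<open>Stated for arbitrary sequences, so that one relation covers rays, single vertices (as
  constant sequences) and projections of rays, which may repeat vertices. It is not reflexive:
  \<open>tail_connected K p p\<close> says that \<open>p\<close> eventually stays within one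
  component.\<close>

definition tail_connected :: "'a ugraph \<Rightarrow> (nat \<Rightarrow> 'a) \<Rightarrow> (nat \<Rightarrow> 'a) \<Rightarrow> bool" where
  "tail_connected K p q \<longleftrightarrow> (\<exists>N. \<forall>m\<ge>N. \<forall>n\<ge>N. (adj K)\<^sup>*\<^sup>* (p m) (q n))"

lemma adj_commute: "adj K u v \<longleftrightarrow> adj K v u"
  by (simp add: adj_def insert_commute)

lemma reachable_sym: "(adj K)\<^sup>*\<^sup>* u v \<Longrightarrow> (adj K)\<^sup>*\<^sup>* v u"
  by (metis adj_commute sympD sympI symp_rtranclp)

lemma tail_connected_sym: "tail_connected K p q \<Longrightarrow> tail_connected K q p"
  unfolding tail_connected_def by (meson reachable_sym)

lemma tail_connected_trans [trans]:
  assumes "tail_connected K p q" "tail_connected K q r"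
  shows "tail_connected K p r"
proof -
  obtain M N where "\<forall>m\<ge>M. \<forall>n\<ge>M. (adj K)\<^sup>*\<^sup>* (p m) (q n)" "\<forall>m\<ge>N. \<forall>n\<ge>N. (adj K)\<^sup>*\<^sup>* (q m) (r n)"
    using assms unfolding tail_connected_def by blast
  then have "\<forall>m\<ge>max M N. \<forall>n\<ge>max M N. (adj K)\<^sup>*\<^sup>* (p m) (r n)"
    by (meson max.boundedE order_refl rtranclp_trans)
  then show ?thesis
    unfolding tail_connected_def by blast
qed

text \<open>An edge of \<open>K\<close> may become a walk of \<open>L\<close>, in particular a
  single vertex. With \<open>f = fst\<close> this projects the blown-up graph to \<open>G\<close>;
  with the identity it passes to a smaller set of deleted edges.\<close>

lemma tail_connected_map:
  assumes "tail_connected K p q" "\<And>x y. adj K x y \<Longrightarrow> (adj L)\<^sup>*\<^sup>* (f x) (f y)"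
  shows "tail_connected L (\<lambda>n. f (p n)) (\<lambda>n. f (q n))"
proof -
  have "(adj L)\<^sup>*\<^sup>* (f x) (f y)" if "(adj K)\<^sup>*\<^sup>* x y" for x y
    using that by (induction) (auto intro: rtranclp_trans assms(2))
  with assms(1) show ?thesis
    unfolding tail_connected_def by blast
qed

text \<open>Each sequence eventually settles in one component, and a late common value shows that
  the two components coincide.\<close>

lemma tail_connected_of_frequently:
  assumes "tail_connected K p p" "tail_connected K q q" "\<And>N. \<exists>m\<ge>N. \<exists>n\<ge>N. p m = q n"
  shows "tail_connected K p q"
proof -
  obtain M N where M: "\<forall>m\<ge>M. \<forall>n\<ge>M. (adj K)\<^sup>*\<^sup>* (p m) (p n)" and N: "\<forall>m\<ge>N. \<forall>n\<ge>N. (adj K)\<^sup>*\<^sup>* (q m) (q n)"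
    using assms unfolding tail_connected_def by blast
  obtain a b where "a \<ge> max M N" "b \<ge> max M N" "p a = q b"
    using assms(3) by blast
  then have "\<forall>m\<ge>max M N. \<forall>n\<ge>max M N. (adj K)\<^sup>*\<^sup>* (p m) (q n)"
    using M N by (metis max.boundedE rtranclp_trans)
  then show ?thesis
    unfolding tail_connected_def by blast
qed

lemma tail_connected_const:
  "tail_connected K (\<lambda>_. v) p \<longleftrightarrow> (\<exists>N. \<forall>n\<ge>N. (adj K)\<^sup>*\<^sup>* v (p n))"
  unfolding tail_connected_def by blast

section \<open>Components and tails of rays\<close>

lemma component_of_vert_eq_iff:
  assumes "u \<in> verts K" "v \<in> verts K"
  shows "component_of_vert K u = component_of_vert K v \<longleftrightarrow> (adj K)\<^sup>*\<^sup>* u v"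
proof
  assume "component_of_vert K u = component_of_vert K v"
  moreover have "v \<in> component_of_vert K v"
    using assms by (simp add: component_of_vert_def)
  ultimately show "(adj K)\<^sup>*\<^sup>* u v"
    by (auto simp: component_of_vert_def)
next
  assume "(adj K)\<^sup>*\<^sup>* u v"
  then show "component_of_vert K u = component_of_vert K v"
    unfolding component_of_vert_def by (auto intro: rtranclp_trans reachable_sym)
qed

lemma component_eq:
  assumes "C \<in> graph_components K" "v \<in> C"
  shows "v \<in> verts K" "C = component_of_vert K v"
proof -
  obtain u where u: "u \<in> verts K" "C = component_of_vert K u"
    using assms by (auto simp: graph_components_def)
  then show v: "v \<in> verts K"
    using assms by (auto simp: component_of_vert_def)
  show "C = component_of_vert K v"
    using u v assms(2) component_of_vert_eq_iff[of u K v] by (simp add: component_of_vert_def)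
qed

lemma ray_reachable: 
  assumes "ray K r"
  shows "(adj K)\<^sup>*\<^sup>* (r m) (r n)"
proof -
  have "(adj K)\<^sup>*\<^sup>* (r 0) (r n)" for n
    using assms by (induction n) (auto simp: ray_def intro: rtranclp.rtrancl_into_rtrancl)
  then show ?thesis
    by (meson reachable_sym rtranclp_trans)
qed

lemma tail_tail: "tail m (tail n r) = tail (n + m) r"
  by (simp add: tail_def add.assoc)

lemma ray_tail: "ray K r \<Longrightarrow> ray K (tail n r)"
  unfolding ray_def tail_def by (auto intro!: injI dest: injD)

lemma ray_tail_mono: "ray K (tail m r) \<Longrightarrow> m \<le> n \<Longrightarrow> ray K (tail n r)"
  by (metis le_add_diff_inverse ray_tail tail_tail)

lemma tail_apply: "n \<le> m \<Longrightarrow> tail n r (m - n) = r m"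
  by (simp add: tail_def)

lemma tail_reachable:
  "ray K (tail k r) \<Longrightarrow> k \<le> m \<Longrightarrow> k \<le> n \<Longrightarrow> (adj K)\<^sup>*\<^sup>* (r m) (r n)"
  by (metis ray_reachable tail_apply)

lemma tail_in_verts: "ray K (tail k r) \<Longrightarrow> k \<le> m \<Longrightarrow> r m \<in> verts K"
  by (metis ray_def rangeI subsetD tail_apply)

lemma tail_connected_refl: "ray K (tail k r) \<Longrightarrow> tail_connected K r r"
  unfolding tail_connected_def using tail_reachable by blast

lemma has_tail_in_component_iff:
  assumes "ray K (tail k r)" and "v \<in> verts K"
  shows "has_tail_in K r (component_of_vert K v) \<longleftrightarrow> (\<exists>N. \<forall>n\<ge>N. (adj K)\<^sup>*\<^sup>* v (r n))"
proof
  assume "has_tail_in K r (component_of_vert K v)"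
  then obtain N where "range (tail N r) \<subseteq> component_of_vert K v"
    by (auto simp: has_tail_in_def)
  then have "\<forall>n\<ge>N. (adj K)\<^sup>*\<^sup>* v (r n)"
    by (metis (no_types, lifting) component_of_vert_def mem_Collect_eq rangeI subsetD tail_apply)
  then show "\<exists>N. \<forall>n\<ge>N. (adj K)\<^sup>*\<^sup>* v (r n)" ..
next
  assume "\<exists>N. \<forall>n\<ge>N. (adj K)\<^sup>*\<^sup>* v (r n)"
  then obtain N where N: "\<forall>n\<ge>N. (adj K)\<^sup>*\<^sup>* v (r n)" ..
  have "ray K (tail (max k N) r)"
    using assms(1) ray_tail_mono by (metis max.cobounded1)
  moreover have "tail (max k N) r i \<in> component_of_vert K v" for i
    using N tail_in_verts[OF assms(1)] by (simp add: component_of_vert_def tail_def)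
  ultimately show "has_tail_in K r (component_of_vert K v)"
    by (auto simp: has_tail_in_def)
qed

text \<open>Replaces components by reachability. Only some tail of each sequence has to be a ray of
  \<open>K\<close>, because \<open>K\<close> will be the graph after a deletion, which may destroy
  initial segments.\<close>

lemma tails_in_different_components_iff:
  assumes r: "ray K (tail k r)" and s: "ray K (tail l s)"
  shows "tails_in_different_components K r s \<longleftrightarrow> \<not> tail_connected K r s"
proof
  assume "tails_in_different_components K r s"
  then obtain u v where uv: "u \<in> verts K" "v \<in> verts K"
      "component_of_vert K u \<noteq> component_of_vert K v"
      "has_tail_in K r (component_of_vert K u)" "has_tail_in K s (component_of_vert K v)"
    by (auto simp: tails_in_different_components_def graph_components_def)
  then have ru: "tail_connected K (\<lambda>_. u) r" and sv: "tail_connected K (\<lambda>_. v) s"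
    using has_tail_in_component_iff[OF r] has_tail_in_component_iff[OF s]
    by (auto simp: tail_connected_const)
  show "\<not> tail_connected K r s"
  proof
    assume "tail_connected K r s"
    then have "tail_connected K (\<lambda>_. u) (\<lambda>_. v)"
      using ru sv tail_connected_sym tail_connected_trans by metis
    then show False
      using uv by (auto simp: tail_connected_def component_of_vert_eq_iff)
  qed
next
  assume not_con: "\<not> tail_connected K r s"
  have vs: "r k \<in> verts K" "s l \<in> verts K"
    using r s tail_in_verts by blast+
  have t: "has_tail_in K r (component_of_vert K (r k))" "has_tail_in K s (component_of_vert K (s l))"
    using has_tail_in_component_iff[OF r vs(1)] has_tail_in_component_iff[OF s vs(2)]
      tail_reachable[OF r] tail_reachable[OF s] by blast+
  have "\<not> (adj K)\<^sup>*\<^sup>* (r k) (s l)"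
  proof
    assume "(adj K)\<^sup>*\<^sup>* (r k) (s l)"
    then have "\<forall>m\<ge>max k l. \<forall>n\<ge>max k l. (adj K)\<^sup>*\<^sup>* (r m) (s n)"
      using tail_reachable[OF r] tail_reachable[OF s]
      by (meson max.boundedE order_refl rtranclp_trans)
    then show False
      using not_con unfolding tail_connected_def by blast
  qed
  then show "tails_in_different_components K r s"
    unfolding tails_in_different_components_def graph_components_def
    using vs t component_of_vert_eq_iff[OF vs] by blast
qed

section \<open>Deleting finitely many edges or vertices\<close>

lemma adj_del_edges: "adj (del_edges G F) u v \<longleftrightarrow> adj G u v \<and> {u, v} \<notin> F"
  by (auto simp: adj_def del_edges_def)

lemma adj_del_verts: "adj (del_verts G S) u v \<longleftrightarrow> adj G u v \<and> u \<notin> S \<and> v \<notin> S"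
  by (auto simp: adj_def del_verts_def)

lemma ray_eventually_avoids:
  assumes "ray G r" "finite S"
  shows "\<exists>N. \<forall>n\<ge>N. r n \<notin> S"
proof -
  have "finite {n. r n \<in> S}"
    using assms finite_vimageI[of S r] by (simp add: ray_def vimage_def)
  then show ?thesis
    by (metis (mono_tags, lifting) finite_nat_set_iff_bounded leD mem_Collect_eq)
qed

lemma ray_tail_del_verts:
  assumes "ray G r" "finite S"
  shows "\<exists>k. ray (del_verts G S) (tail k r)"
proof -
  obtain N where N: "\<forall>n\<ge>N. r n \<notin> S"
    using ray_eventually_avoids[OF assms] by blast
  have "ray (del_verts G S) (tail N r)"
    using ray_tail[OF assms(1), of N] N
    unfolding ray_def adj_del_verts by (auto simp: tail_def del_verts_def)
  then show ?thesis ..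
qed

lemma ray_tail_del_edges:
  assumes "ray G r" "finite F"
  shows "\<exists>k. ray (del_edges G F) (tail k r)"
proof -
  \<comment> \<open>An edge occurs at most once along a ray, so a finite \<open>F\<close> affects
    only finitely many positions. The crossed match of two edges would require
    \<open>m = Suc n\<close> and \<open>Suc m = n\<close>.\<close>
  have "inj (\<lambda>n. {r n, r (Suc n)})"
  proof (rule injI)
    fix m n assume "{r m, r (Suc m)} = {r n, r (Suc n)}"
    then have "(m = n \<and> Suc m = Suc n) \<or> (m = Suc n \<and> Suc m = n)"
      using assms(1) by (auto simp: doubleton_eq_iff ray_def dest: injD)
    then show "m = n"
      by auto
  qed
  then have "finite {n. {r n, r (Suc n)} \<in> F}"
    using assms finite_vimageI[of F "\<lambda>n. {r n, r (Suc n)}"] by (simp add: vimage_def)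
  then obtain N where "\<forall>n\<ge>N. {r n, r (Suc n)} \<notin> F"
    by (metis (mono_tags, lifting) finite_nat_set_iff_bounded leD mem_Collect_eq)
  then have "ray (del_edges G F) (tail N r)"
    using ray_tail[OF assms(1), of N]
    unfolding ray_def adj_del_edges by (auto simp: tail_def del_edges_def)
  then show ?thesis ..
qed

lemma edge_separates_iff:
  assumes "ray G r" "ray G s" "finite F"
  shows "edge_separates G F r s \<longleftrightarrow> \<not> tail_connected (del_edges G F) r s"
proof -
  obtain k l where "ray (del_edges G F) (tail k r)" "ray (del_edges G F) (tail l s)"
    using ray_tail_del_edges[OF assms(1,3)] ray_tail_del_edges[OF assms(2,3)] by blast
  then show ?thesis
    unfolding edge_separates_def by (rule tails_in_different_components_iff)
qed

lemma vert_separates_iff: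
  assumes "ray G r" "ray G s" "finite S"
  shows "vert_separates G S r s \<longleftrightarrow> \<not> tail_connected (del_verts G S) r s"
proof -
  obtain k l where "ray (del_verts G S) (tail k r)" "ray (del_verts G S) (tail l s)"
    using ray_tail_del_verts[OF assms(1,3)] ray_tail_del_verts[OF assms(2,3)] by blast
  then show ?thesis
    unfolding vert_separates_def by (rule tails_in_different_components_iff)
qed

text \<open>Reading \<open>v\<close> as a constant sequence puts domination in the same form as
  equivalence of rays, so the two can be chained by transitivity.\<close>

lemma edge_dominates_iff:
  assumes r: "ray G r" and v: "v \<in> verts G"
  shows "edge_dominates G v r \<longleftrightarrow>
    (\<forall>F. finite F \<and> F \<subseteq> edges G \<longrightarrow> tail_connected (del_edges G F) (\<lambda>_. v) r)"
proof -
  have "(\<exists>C\<in>graph_components (del_edges G F). v \<in> C \<and> has_tail_in (del_edges G F) r C) \<longleftrightarrow>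
      tail_connected (del_edges G F) (\<lambda>_. v) r" if F: "finite F" for F
  proof -
    let ?K = "del_edges G F"
    have v': "v \<in> verts ?K"
      using v by (simp add: del_edges_def)
    then have "v \<in> component_of_vert ?K v" "component_of_vert ?K v \<in> graph_components ?K"
      by (auto simp: component_of_vert_def graph_components_def)
    then have "(\<exists>C\<in>graph_components ?K. v \<in> C \<and> has_tail_in ?K r C) \<longleftrightarrow>
        has_tail_in ?K r (component_of_vert ?K v)"
      using component_eq(2) by metis
    also have "\<dots> \<longleftrightarrow> tail_connected ?K (\<lambda>_. v) r"
      using ray_tail_del_edges[OF r F] has_tail_in_component_iff v' tail_connected_const by metis
    finally show ?thesis .
  qed
  then show ?thesis
    unfolding edge_dominates_def by (simp cong: conj_cong imp_cong)
qed

section \<open>Inseparable sequences\<close>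

definition inseparable :: "'a ugraph \<Rightarrow> (nat \<Rightarrow> 'a) \<Rightarrow> (nat \<Rightarrow> 'a) \<Rightarrow> bool" where
  "inseparable G p q \<longleftrightarrow>
     (\<forall>F. finite F \<and> F \<subseteq> edges G \<longrightarrow> tail_connected (del_edges G F) p q)"

lemma inseparable_sym: "inseparable G p q \<Longrightarrow> inseparable G q p"
  unfolding inseparable_def by (meson tail_connected_sym)

lemma inseparable_trans [trans]: "inseparable G p q \<Longrightarrow> inseparable G q r \<Longrightarrow> inseparable G p r"
  unfolding inseparable_def by (meson tail_connected_trans)

lemma inseparable_refl:
  assumes "ray G r"
  shows "inseparable G r r"
  unfolding inseparable_def
proof (intro allI impI)
  fix F assume "finite F \<and> F \<subseteq> edges G"
  then obtain k where "ray (del_edges G F) (tail k r)"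
    using assms ray_tail_del_edges by blast
  then show "tail_connected (del_edges G F) r r"
    by (rule tail_connected_refl)
qed

lemma inseparable_of_frequently:
  assumes "inseparable G p p" "inseparable G q q" "\<And>N. \<exists>m\<ge>N. \<exists>n\<ge>N. p m = q n"
  shows "inseparable G p q"
  unfolding inseparable_def
proof (intro allI impI)
  fix F assume F: "finite F \<and> F \<subseteq> edges G"
  show "tail_connected (del_edges G F) p q"
    by (rule tail_connected_of_frequently[OF _ _ assms(3)])
      (use assms F in \<open>simp_all add: inseparable_def\<close>)
qed

definition vert_inseparable :: "'a ugraph \<Rightarrow> (nat \<Rightarrow> 'a) \<Rightarrow> (nat \<Rightarrow> 'a) \<Rightarrow> bool" where
  "vert_inseparable G p q \<longleftrightarrow>
     (\<forall>S. finite S \<and> S \<subseteq> verts G \<longrightarrow> tail_connected (del_verts G S) p q)"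

lemma vert_inseparable_sym: "vert_inseparable G p q \<Longrightarrow> vert_inseparable G q p"
  unfolding vert_inseparable_def by (meson tail_connected_sym)

lemma vert_inseparable_trans:
  "vert_inseparable G p q \<Longrightarrow> vert_inseparable G q r \<Longrightarrow> vert_inseparable G p r"
  unfolding vert_inseparable_def by (meson tail_connected_trans)

lemma vert_inseparable_refl:
  assumes "ray G r"
  shows "vert_inseparable G r r"
  unfolding vert_inseparable_def
proof (intro allI impI)
  fix S assume "finite S \<and> S \<subseteq> verts G"
  then obtain k where "ray (del_verts G S) (tail k r)"
    using assms ray_tail_del_verts by blast
  then show "tail_connected (del_verts G S) r r"
    by (rule tail_connected_refl)
qed

lemma edge_end_rel_iff: "(r, s) \<in> edge_end_rel G \<longleftrightarrow> ray G r \<and> ray G s \<and> inseparable G r s"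
  by (auto simp: edge_end_rel_def inseparable_def edge_separates_iff)

lemma end_rel_iff: "(r, s) \<in> end_rel G \<longleftrightarrow> ray G r \<and> ray G s \<and> vert_inseparable G r s"
  by (auto simp: end_rel_def vert_inseparable_def vert_separates_iff)

lemma equiv_end_rel: "equiv {r. ray G r} (end_rel G)"
proof (rule equivI)
  show "end_rel G \<subseteq> {r. ray G r} \<times> {r. ray G r}"
    by (auto simp: end_rel_iff)
  show "refl_on {r. ray G r} (end_rel G)"
    by (simp add: refl_on_def end_rel_iff vert_inseparable_refl)
  show "sym (end_rel G)"
    unfolding sym_def end_rel_iff by (meson vert_inseparable_sym)
  show "trans (end_rel G)"
    unfolding trans_def end_rel_iff by (meson vert_inseparable_trans)
qed

section \<open>Ends, edge-ends and their basic neighbourhoods\<close>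

lemma ends_eq: "ends G = {end_rel G `` {r} | r. ray G r}"
  by (simp add: ends_def quotient_def UNION_singleton_eq_range setcompr_eq_image)

lemma edge_ends_eq: "edge_ends G = {edge_end_rel G `` {r} | r. ray G r}"
  by (simp add: edge_ends_def quotient_def UNION_singleton_eq_range setcompr_eq_image)

lemma end_nbhd_self:
  assumes "ray G r" "finite S" "S \<subseteq> verts G"
  shows "end_rel G `` {r} \<in> end_nbhd G S r"
proof -
  have "\<not> vert_separates G S r r"
    using assms vert_inseparable_refl vert_separates_iff unfolding vert_inseparable_def by blast
  then show ?thesis
    using assms(1) unfolding end_nbhd_def by blast
qed

lemma edge_end_nbhd_self:
  assumes "ray G r" "finite F" "F \<subseteq> edges G"
  shows "edge_end_rel G `` {r} \<in> edge_end_nbhd G F r"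
proof -
  have "\<not> edge_separates G F r r"
    using assms inseparable_refl edge_separates_iff unfolding inseparable_def by blast
  then show ?thesis
    using assms(1) unfolding edge_end_nbhd_def by blast
qed

text \<open>Membership in the neighbourhood only provides some representative \<open>t\<close> of
  the class that \<open>F\<close> does not separate from \<open>r\<close>. Since \<open>F\<close> is
  finite, it does not separate \<open>t\<close> from \<open>s\<close> either, so the criterion holds
  for every representative.\<close>

lemma edge_end_in_nbhd_iff:
  assumes "ray G r" "ray G s" "finite F" "F \<subseteq> edges G"
  shows "edge_end_rel G `` {s} \<in> edge_end_nbhd G F r \<longleftrightarrow> tail_connected (del_edges G F) r s"
proof
  assume "edge_end_rel G `` {s} \<in> edge_end_nbhd G F r"
  then obtain t where t: "edge_end_rel G `` {s} = edge_end_rel G `` {t}" "ray G t" "\<not> edge_separates G F r t"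
    unfolding edge_end_nbhd_def mem_Collect_eq by (elim exE conjE)
  then have "(t, s) \<in> edge_end_rel G"
    using assms(2) by (metis Image_singleton_iff edge_end_rel_iff inseparable_refl)
  then have "tail_connected (del_edges G F) t s"
    using assms by (simp add: edge_end_rel_iff inseparable_def)
  then show "tail_connected (del_edges G F) r s"
    using t assms edge_separates_iff tail_connected_trans by metis
next
  assume "tail_connected (del_edges G F) r s"
  then have "\<not> edge_separates G F r s"
    using assms edge_separates_iff by metis
  then show "edge_end_rel G `` {s} \<in> edge_end_nbhd G F r"
    using assms(2) unfolding edge_end_nbhd_def by blast
qed

lemma end_in_nbhd_iff:
  assumes "ray K r" "ray K s" "finite S" "S \<subseteq> verts K"
  shows "end_rel K `` {s} \<in> end_nbhd K S r \<longleftrightarrow> tail_connected (del_verts K S) r s"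
proof
  assume "end_rel K `` {s} \<in> end_nbhd K S r"
  then obtain t where t: "end_rel K `` {s} = end_rel K `` {t}" "ray K t" "\<not> vert_separates K S r t"
    unfolding end_nbhd_def mem_Collect_eq by (elim exE conjE)
  then have "(t, s) \<in> end_rel K"
    using assms(2) by (metis Image_singleton_iff end_rel_iff vert_inseparable_refl)
  then have "tail_connected (del_verts K S) t s"
    using assms by (simp add: end_rel_iff vert_inseparable_def)
  then show "tail_connected (del_verts K S) r s"
    using t assms vert_separates_iff tail_connected_trans by metis
next
  assume "tail_connected (del_verts K S) r s"
  then have "\<not> vert_separates K S r s"
    using assms vert_separates_iff by metis
  then show "end_rel K `` {s} \<in> end_nbhd K S r"
    using assms(2) unfolding end_nbhd_def by blast
qed

lemma topspace_end_space: "topspace (end_space G) = ends G"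
proof
  have "end_nbhd G S r \<subseteq> ends G" for S r
    unfolding end_nbhd_def ends_eq by (rule Collect_mono) metis
  then show "topspace (end_space G) \<subseteq> ends G"
    unfolding end_space_def topology_generated_by_topspace by fast
  show "ends G \<subseteq> topspace (end_space G)"
  proof
    fix \<omega> assume "\<omega> \<in> ends G"
    then obtain r where r: "ray G r" "\<omega> = end_rel G `` {r}"
      unfolding ends_eq mem_Collect_eq by (elim exE conjE)
    then have "\<omega> \<in> end_nbhd G {} r"
      by (simp add: end_nbhd_self)
    moreover have "end_nbhd G {} r \<in> {end_nbhd G S r | S r. finite S \<and> S \<subseteq> verts G \<and> ray G r}"
      using r(1) unfolding mem_Collect_eq by (metis empty_subsetI finite.emptyI)
    ultimately show "\<omega> \<in> topspace (end_space G)"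
      unfolding end_space_def topology_generated_by_topspace by (rule UnionI[rotated])
  qed
qed

lemma topspace_edge_end_space: "topspace (edge_end_space G) = edge_ends G"
proof
  have "edge_end_nbhd G F r \<subseteq> edge_ends G" for F r
    unfolding edge_end_nbhd_def edge_ends_eq by (rule Collect_mono) metis
  then show "topspace (edge_end_space G) \<subseteq> edge_ends G"
    unfolding edge_end_space_def topology_generated_by_topspace by fast
  show "edge_ends G \<subseteq> topspace (edge_end_space G)"
  proof
    fix \<omega> assume "\<omega> \<in> edge_ends G"
    then obtain r where r: "ray G r" "\<omega> = edge_end_rel G `` {r}"
      unfolding edge_ends_eq mem_Collect_eq by (elim exE conjE)
    then have "\<omega> \<in> edge_end_nbhd G {} r"
      by (simp add: edge_end_nbhd_self)
    moreover have "edge_end_nbhd G {} r \<in>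
        {edge_end_nbhd G F r | F r. finite F \<and> F \<subseteq> edges G \<and> ray G r}"
      using r(1) unfolding mem_Collect_eq by (metis empty_subsetI finite.emptyI)
    ultimately show "\<omega> \<in> topspace (edge_end_space G)"
      unfolding edge_end_space_def topology_generated_by_topspace by (rule UnionI[rotated])
  qed
qed

lemma openin_end_nbhd:
  assumes "ray G r" "finite S" "S \<subseteq> verts G"
  shows "openin (end_space G) (end_nbhd G S r)"
  unfolding end_space_def using assms by (intro topology_generated_by_Basis CollectI exI conjI) simp_all

lemma openin_edge_end_nbhd:
  assumes "ray G r" "finite F" "F \<subseteq> edges G"
  shows "openin (edge_end_space G) (edge_end_nbhd G F r)"
  unfolding edge_end_space_def using assms by (intro topology_generated_by_Basis CollectI exI conjI) simp_all

text \<open>Continuity can be tested at each point \<open>x\<close> on neighbourhoods centred at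
  representatives of \<open>f x\<close> itself, since a basic set contains the basic set for the
  same \<open>S\<close> around each of its points.\<close>

lemma continuous_map_to_end_spaceI:
  assumes f: "f \<in> topspace X \<rightarrow> ends K"
    and nbhd: "\<And>x S s. x \<in> topspace X \<Longrightarrow> finite S \<Longrightarrow> S \<subseteq> verts K \<Longrightarrow> ray K s \<Longrightarrow> f x = end_rel K `` {s} \<Longrightarrow>
      \<exists>T. openin X T \<and> x \<in> T \<and> f ` T \<subseteq> end_nbhd K S s"
  shows "continuous_map X (end_space K) f"
  unfolding end_space_def
proof (rule continuous_on_generated_topo)
  show "f ` topspace X \<subseteq> \<Union> {end_nbhd K S r | S r. finite S \<and> S \<subseteq> verts K \<and> ray K r}"
    using f unfolding end_space_def[symmetric] topology_generated_by_topspace[symmetric] topspace_end_space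
    by blast
  fix U assume "U \<in> {end_nbhd K S r | S r. finite S \<and> S \<subseteq> verts K \<and> ray K r}"
  then obtain S r where U: "U = end_nbhd K S r" "finite S" "S \<subseteq> verts K" "ray K r"
    unfolding mem_Collect_eq by (elim exE conjE)
  show "openin X (f -` U \<inter> topspace X)"
  proof (subst openin_subopen, rule ballI)
    fix x assume "x \<in> f -` U \<inter> topspace X"
    then have x: "f x \<in> U" "x \<in> topspace X"
      by auto
    then obtain s where s: "ray K s" "f x = end_rel K `` {s}" "\<not> vert_separates K S r s"
      unfolding U(1) end_nbhd_def mem_Collect_eq by (elim exE conjE)
    \<comment> \<open>Recentring: for a fixed finite \<open>S\<close>, not being separated by
      \<open>S\<close> is transitive.\<close>
    have "end_nbhd K S s \<subseteq> U"
    proof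
      fix \<eta> assume "\<eta> \<in> end_nbhd K S s"
      then obtain t where t: "\<eta> = end_rel K `` {t}" "ray K t" "\<not> vert_separates K S s t"
        unfolding end_nbhd_def mem_Collect_eq by (elim exE conjE)
      then have "tail_connected (del_verts K S) r t"
        using s U(2,4) vert_separates_iff tail_connected_trans by metis
      then show "\<eta> \<in> U"
        using t end_in_nbhd_iff U by metis
    qed
    moreover obtain T where "openin X T" "x \<in> T" "f ` T \<subseteq> end_nbhd K S s"
      using nbhd[OF x(2) U(2,3) s(1,2)] by blast
    ultimately show "\<exists>T. openin X T \<and> x \<in> T \<and> T \<subseteq> f -` U \<inter> topspace X"
      by (meson Int_greatest image_subset_iff_subset_vimage openin_subset subset_trans)
  qed
qed

lemma continuous_map_to_edge_end_spaceI:
  assumes f: "f \<in> topspace X \<rightarrow> edge_ends K"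
    and nbhd: "\<And>x F s. x \<in> topspace X \<Longrightarrow> finite F \<Longrightarrow> F \<subseteq> edges K \<Longrightarrow> ray K s \<Longrightarrow> f x = edge_end_rel K `` {s} \<Longrightarrow>
      \<exists>T. openin X T \<and> x \<in> T \<and> f ` T \<subseteq> edge_end_nbhd K F s"
  shows "continuous_map X (edge_end_space K) f"
  unfolding edge_end_space_def
proof (rule continuous_on_generated_topo)
  show "f ` topspace X \<subseteq> \<Union> {edge_end_nbhd K F r | F r. finite F \<and> F \<subseteq> edges K \<and> ray K r}"
    using f unfolding edge_end_space_def[symmetric] topology_generated_by_topspace[symmetric]
      topspace_edge_end_space by blast
  fix U assume "U \<in> {edge_end_nbhd K F r | F r. finite F \<and> F \<subseteq> edges K \<and> ray K r}"
  then obtain F r where U: "U = edge_end_nbhd K F r" "finite F" "F \<subseteq> edges K" "ray K r"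
    unfolding mem_Collect_eq by (elim exE conjE)
  show "openin X (f -` U \<inter> topspace X)"
  proof (subst openin_subopen, rule ballI)
    fix x assume "x \<in> f -` U \<inter> topspace X"
    then have x: "f x \<in> U" "x \<in> topspace X"
      by auto
    then obtain s where s: "ray K s" "f x = edge_end_rel K `` {s}" "\<not> edge_separates K F r s"
      unfolding U(1) edge_end_nbhd_def mem_Collect_eq by (elim exE conjE)
    have "edge_end_nbhd K F s \<subseteq> U"
    proof
      fix \<eta> assume "\<eta> \<in> edge_end_nbhd K F s"
      then obtain t where t: "\<eta> = edge_end_rel K `` {t}" "ray K t" "\<not> edge_separates K F s t"
        unfolding edge_end_nbhd_def mem_Collect_eq by (elim exE conjE)
      then have "tail_connected (del_edges K F) r t"
        using s U(2,4) edge_separates_iff tail_connected_trans by metis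
      then show "\<eta> \<in> U"
        using t edge_end_in_nbhd_iff U by metis
    qed
    moreover obtain T where "openin X T" "x \<in> T" "f ` T \<subseteq> edge_end_nbhd K F s"
      using nbhd[OF x(2) U(2,3) s(1,2)] by blast
    ultimately show "\<exists>T. openin X T \<and> x \<in> T \<and> T \<subseteq> f -` U \<inter> topspace X"
      by (meson Int_greatest image_subset_iff_subset_vimage openin_subset subset_trans)
  qed
qed

section \<open>Blowing up the vertices\<close>

definition edge_dominating :: "'a ugraph \<Rightarrow> 'a \<Rightarrow> bool" where
  "edge_dominating G v \<longleftrightarrow> (\<exists>r. ray G r \<and> edge_dominates G v r)"

text \<open>A simple graph has no loops, so the pair \<open>(v, v)\<close> is not a half-edge and is
  free to serve as centre. The centre may stand on either side, which keeps the relation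
  symmetric.\<close>

definition blowup_adj :: "'a ugraph \<Rightarrow> 'a \<times> 'a \<Rightarrow> 'a \<times> 'a \<Rightarrow> bool" where
  "blowup_adj G = (\<lambda>(v, u) (w, t).
     adj G v u \<and> w = u \<and> t = v \<or>
     w = v \<and> (u = v \<and> adj G v t \<or> t = v \<and> adj G v u \<or>
               edge_dominating G v \<and> adj G v u \<and> adj G v t \<and> u \<noteq> t))"

definition blowup :: "'a ugraph \<Rightarrow> ('a \<times> 'a) ugraph" where
  "blowup G = \<lparr>verts = {(v, u). v \<in> verts G \<and> (u = v \<or> adj G v u)},
               edges = {{x, y} | x y. blowup_adj G x y}\<rparr>"

lemma blowup_adj_commute: "blowup_adj G x y \<longleftrightarrow> blowup_adj G y x"
  by (cases x; cases y) (auto simp: blowup_adj_def adj_commute)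

lemma adj_blowup: "adj (blowup G) x y \<longleftrightarrow> blowup_adj G x y"
proof
  assume "adj (blowup G) x y"
  then obtain a b where "{x, y} = {a, b}" "blowup_adj G a b"
    unfolding adj_def blowup_def by auto
  then show "blowup_adj G x y"
    using blowup_adj_commute by (metis doubleton_eq_iff)
next
  assume "blowup_adj G x y"
  then show "adj (blowup G) x y"
    unfolding adj_def blowup_def ugraph.select_convs by blast
qed

lemma in_verts_blowup: "(v, u) \<in> verts (blowup G) \<longleftrightarrow> v \<in> verts G \<and> (u = v \<or> adj G v u)"
  by (simp add: blowup_def)

text \<open>Both orientations of each edge are included. This turns a finite set of edges of
  \<open>G\<close> into a finite set of vertices of \<open>blowup G\<close>.\<close>

definition half_edges :: "'a set set \<Rightarrow> ('a \<times> 'a) set" where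
  "half_edges F = {(u, w). {u, w} \<in> F}"

text \<open>An edge inside a star or clique collapses to one vertex, and any other edge projects to
  an edge of \<open>G\<close>. Only the joining edges over \<open>F\<close> are excluded, so the
  result serves deletions of half-edges as well as deletions of edges in the blown-up graph.\<close>

lemma adj_blowup_projects:
  assumes "adj (blowup G) x y" "\<not> (x \<in> half_edges F \<and> y = (snd x, fst x))"
  shows "(adj (del_edges G F))\<^sup>*\<^sup>* (fst x) (fst y)"
  using assms unfolding adj_blowup blowup_adj_def
  by (auto simp: half_edges_def adj_del_edges split: prod.splits)

text \<open>Loop erasure: go to the last visit of the current vertex, take one step, and repeat.
  Last visits exist because every vertex occurs finitely often, and no vertex left in this way is
  met again.\<close>

lemma finite_occurrences_ray:
  assumes adj: "\<And>n. p (Suc n) = p n \<or> adj G (p n) (p (Suc n))"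
    and verts: "range p \<subseteq> verts G"
    and fin: "\<And>v. finite {n. p n = v}"
  shows "\<exists>k. strict_mono k \<and> ray G (\<lambda>i. p (k i))"
proof -
  define last where "last n = Max {m. p m = p n}" for n
  have last: "p (last n) = p n" "n \<le> last n" for n
  proof -
    have "last n \<in> {m. p m = p n}"
      unfolding last_def by (rule Max_in) (auto simp: fin)
    then show "p (last n) = p n"
      by simp
    show "n \<le> last n"
      unfolding last_def by (rule Max_ge) (auto simp: fin)
  qed
  have last_less: "p m \<noteq> p (last n)" if "last n < m" for m n
    using that Max_ge[OF fin, of m "p n"] last(1)[of n] unfolding last_def by force
  \<comment> \<open>The position right after a last visit carries a new vertex; the next index is
    the last visit of that vertex.\<close>
  define k where "k = rec_nat (last 0) (\<lambda>_ j. last (Suc j))"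
  have k_Suc: "k (Suc i) = last (Suc (k i))" for i
    by (simp add: k_def)
  have k_last: "\<exists>n. k i = last n" for i
    by (cases i) (auto simp: k_def)
  have k_less: "p m \<noteq> p (k i)" if "k i < m" for m i
    using k_last[of i] last_less that by metis
  have mono: "strict_mono k"
    unfolding strict_mono_Suc_iff using k_Suc last(2) by (metis Suc_le_eq)
  have "inj (\<lambda>i. p (k i))"
  proof (rule injI)
    fix i j assume eq: "p (k i) = p (k j)"
    then have "\<not> k i < k j" "\<not> k j < k i"
      using k_less by metis+
    then show "i = j"
      using mono by (meson linorder_neqE_nat strict_monoD)
  qed
  \<comment> \<open>\<open>p\<close> has the same value at \<open>k (Suc i)\<close> as at
    \<open>Suc (k i)\<close>, so the single step of \<open>p\<close> after \<open>k i\<close> is the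
    required edge.\<close>
  moreover have "adj G (p (k i)) (p (k (Suc i)))" for i
    using adj[of "k i"] k_less[of i "Suc (k i)"] by (simp add: k_Suc last(1))
  ultimately have "ray G (\<lambda>i. p (k i))"
    using verts by (auto simp: ray_def)
  with mono show ?thesis
    by blast
qed

section \<open>Projecting the blown-up graph to the original graph\<close>

context
  fixes G :: "'a ugraph"
  assumes simple: "simple_graph G"
begin

lemma adjD: "adj G u v \<Longrightarrow> u \<noteq> v \<and> u \<in> verts G \<and> v \<in> verts G"
  using simple by (force simp: adj_def simple_graph_def)

lemma simple_graph_blowup: "simple_graph (blowup G)"
proof -
  have "x \<noteq> y \<and> x \<in> verts (blowup G) \<and> y \<in> verts (blowup G)" if "blowup_adj G x y" for x y
    using that adjD adj_commute[of G] unfolding blowup_adj_def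
    by (cases x; cases y) (auto simp: in_verts_blowup)
  then show ?thesis
    unfolding simple_graph_def by (fastforce simp: blowup_def card_2_iff)
qed

lemma finite_half_edges:
  assumes "finite F" "F \<subseteq> edges G"
  shows "finite (half_edges F)" "half_edges F \<subseteq> verts (blowup G)"
proof -
  have "finite (\<Union>F)"
    using assms simple unfolding simple_graph_def
    by (metis card.infinite finite_Union subsetD zero_neq_numeral)
  moreover have "half_edges F \<subseteq> \<Union>F \<times> \<Union>F"
    by (auto simp: half_edges_def)
  ultimately show "finite (half_edges F)"
    by (meson finite_SigmaI finite_subset)
  show "half_edges F \<subseteq> verts (blowup G)"
    using assms(2) adjD by (auto simp: half_edges_def in_verts_blowup adj_def)
qed

lemma tail_connected_project:
  assumes "tail_connected (del_verts (blowup G) (half_edges F)) R R'"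
  shows "tail_connected (del_edges G F) (\<lambda>n. fst (R n)) (\<lambda>n. fst (R' n))"
  using assms by (rule tail_connected_map) (auto simp: adj_del_verts intro!: adj_blowup_projects)

lemma inseparable_project:
  assumes "vert_inseparable (blowup G) R R'"
  shows "inseparable G (\<lambda>n. fst (R n)) (\<lambda>n. fst (R' n))"
  unfolding inseparable_def
proof (intro allI impI)
  fix F assume F: "finite F \<and> F \<subseteq> edges G"
  then have "tail_connected (del_verts (blowup G) (half_edges F)) R R'"
    using assms finite_half_edges unfolding vert_inseparable_def by simp
  then show "tail_connected (del_edges G F) (\<lambda>n. fst (R n)) (\<lambda>n. fst (R' n))"
    by (rule tail_connected_project)
qed

text \<open>Domination is tested by deleting edges, so here the joining edges over \<open>F\<close>
  are deleted instead of the half-edges. What remains connected still projects to walks avoiding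
  \<open>F\<close>.\<close>

lemma edge_dominates_project:
  assumes R: "ray (blowup G) R" and x: "x \<in> verts (blowup G)" and dom: "edge_dominates (blowup G) x R"
  shows "inseparable G (\<lambda>_. fst x) (\<lambda>n. fst (R n))"
  unfolding inseparable_def
proof (intro allI impI)
  fix F assume F: "finite F \<and> F \<subseteq> edges G"
  define F' where "F' = (\<lambda>(u, w). {(u, w), (w, u)}) ` half_edges F"
  have "finite F'"
    using F finite_half_edges by (simp add: F'_def)
  moreover have "F' \<subseteq> edges (blowup G)"
  proof
    fix e assume "e \<in> F'"
    then obtain u w where "e = {(u, w), (w, u)}" "{u, w} \<in> F"
      by (auto simp: F'_def half_edges_def)
    moreover from this have "blowup_adj G (u, w) (w, u)"
      using F by (auto simp: blowup_adj_def adj_def)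
    ultimately show "e \<in> edges (blowup G)"
      by (auto simp: blowup_def)
  qed
  ultimately have "tail_connected (del_edges (blowup G) F') (\<lambda>_. x) R"
    using dom edge_dominates_iff[OF R x] by blast
  moreover have "(adj (del_edges G F))\<^sup>*\<^sup>* (fst y) (fst z)" if "adj (del_edges (blowup G) F') y z" for y z
  proof (rule adj_blowup_projects)
    show "adj (blowup G) y z"
      using that by (simp add: adj_del_edges)
    show "\<not> (y \<in> half_edges F \<and> z = (snd y, fst y))"
      using that by (cases y) (auto simp: adj_del_edges F'_def)
  qed
  ultimately show "tail_connected (del_edges G F) (\<lambda>_. fst x) (\<lambda>n. fst (R n))"
    by (rule tail_connected_map)
qed

lemma edge_dominating_if_frequently:
  assumes R: "ray (blowup G) R" and freq: "infinite {n. fst (R n) = v}"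
  shows "edge_dominating G v"
proof (rule ccontr)
  assume timid: "\<not> edge_dominating G v"
  obtain N where N: "\<forall>n\<ge>N. R n \<notin> {(v, v)}"
    using ray_eventually_avoids[OF R] by blast
  \<comment> \<open>The bound is strict so that the predecessor \<open>R m\<close> also lies in the
    part of the ray that avoids the centre.\<close>
  obtain n where n: "n > Suc N" "fst (R n) = v"
    using freq by (metis (mono_tags, lifting) infinite_nat_iff_unbounded mem_Collect_eq)
  then obtain m where m: "n = Suc m" "N \<le> m"
    by (metis Suc_lessE Suc_less_eq less_imp_le_nat)
  obtain u where u: "R n = (v, u)" "u \<noteq> v"
    using n N by (metis Suc_lessD less_imp_le_nat prod.collapse singletonI)
  \<comment> \<open>A leaf of a star has degree 2, so the ray would have to pass through the centre next to it.\<close>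
  have "y = (u, v) \<or> y = (v, v)" if "adj (blowup G) (R n) y" for y
    using that u timid unfolding adj_blowup blowup_adj_def by (auto split: prod.splits)
  moreover have "adj (blowup G) (R n) (R m)" "adj (blowup G) (R n) (R (Suc n))"
    using R m(1) by (auto simp: ray_def adj_commute[of _ "R (Suc m)" "R m"])
  moreover have "R m \<noteq> (v, v)" "R (Suc n) \<noteq> (v, v)"
    using N m by auto
  ultimately have "R m = R (Suc n)"
    by metis
  then show False
    using R m(1) by (auto simp: ray_def dest: injD)
qed

lemma inseparable_project_refl:
  assumes "ray (blowup G) R"
  shows "inseparable G (\<lambda>n. fst (R n)) (\<lambda>n. fst (R n))"
  using assms by (intro inseparable_project vert_inseparable_refl)

lemma obtain_tracking_ray:
  assumes R: "ray (blowup G) R"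
  obtains r where "ray G r" "inseparable G r (\<lambda>n. fst (R n))"
proof (cases "\<exists>v. infinite {n. fst (R n) = v}")
  case True
  then obtain v where v: "infinite {n. fst (R n) = v}"
    by blast
  then obtain r where r: "ray G r" "edge_dominates G v r"
    using edge_dominating_if_frequently[OF R] by (auto simp: edge_dominating_def)
  obtain n where "fst (R n) = v"
    using v not_finite_existsD by blast
  then have "v \<in> verts G"
    using R unfolding ray_def by (metis in_verts_blowup prod.collapse rangeI subsetD)
  then have rv: "inseparable G r (\<lambda>_. v)"
    using r edge_dominates_iff by (metis inseparable_def inseparable_sym)
  \<comment> \<open>The projection takes the value \<open>v\<close> arbitrarily late, so
    \<open>v\<close> as a constant sequence links it to the dominated ray \<open>r\<close>.\<close>
  have "inseparable G (\<lambda>_. v) (\<lambda>n. fst (R n))"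
  proof (rule inseparable_of_frequently)
    show "inseparable G (\<lambda>_. v) (\<lambda>_. v)"
      by (simp add: inseparable_def tail_connected_def)
    show "\<exists>m\<ge>N. \<exists>n\<ge>N. v = fst (R n)" for N
      using v by (metis (mono_tags, lifting) infinite_nat_iff_unbounded_le mem_Collect_eq)
  qed (rule inseparable_project_refl[OF R])
  with rv r(1) that show ?thesis
    using inseparable_trans by blast
next
  case False
  have "fst (R (Suc n)) = fst (R n) \<or> adj G (fst (R n)) (fst (R (Suc n)))" for n
  proof -
    have "adj (blowup G) (R n) (R (Suc n))"
      using R by (simp add: ray_def)
    then show ?thesis
      unfolding adj_blowup blowup_adj_def by (auto split: prod.splits)
  qed
  moreover have "fst (R n) \<in> verts G" for n
    using R in_verts_blowup[of "fst (R n)" "snd (R n)"] by (auto simp: ray_def)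
  ultimately obtain k where k: "strict_mono k" "ray G (\<lambda>i. fst (R (k i)))"
    using finite_occurrences_ray[of "\<lambda>n. fst (R n)" G] False by (auto simp: image_subset_iff)
  \<comment> \<open>The ray is a subsequence of the projection, so the two share values arbitrarily
    late.\<close>
  have "inseparable G (\<lambda>i. fst (R (k i))) (\<lambda>n. fst (R n))"
  proof (rule inseparable_of_frequently)
    show "\<exists>m\<ge>N. \<exists>n\<ge>N. fst (R (k m)) = fst (R n)" for N
    proof (rule exI[of _ N], intro conjI exI[of _ "k N"])
      show "N \<le> k N"
        using strict_mono_imp_increasing[OF k(1)] by simp
    qed simp_all
  qed (use inseparable_refl[OF k(2)] inseparable_project_refl[OF R] in simp_all)
  with k(2) that show ?thesis
    by blast
qed

section \<open>Lifting rays and connections to the blown-up graph\<close>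

lemma obtain_lifted_ray:
  assumes r: "ray G r"
  obtains R where "ray (blowup G) R" "inseparable G r (\<lambda>n. fst (R n))"
proof -
  \<comment> \<open>The lifted ray runs centre, outgoing half-edge, incoming half-edge, next centre,
    thus three steps for each edge of \<open>r\<close>. It uses only edges that exist in stars and
    cliques alike. \<open>i\<close> and \<open>j\<close> index its two coordinates by the residue
    modulo 3.\<close>
  define i j where "i n = (n + 1) div 3" and "j n = n div 3 + (if n mod 3 = 1 then 1 else 0)" for n :: nat
  define R where "R n = (r (i n), r (j n))" for n
  have r_verts: "r n \<in> verts G" for n
    using r by (auto simp: ray_def)
  have r_adj: "adj G (r n) (r (Suc n))" "adj G (r (Suc n)) (r n)" for n
    using r adj_commute[of G] unfolding ray_def by metis+
  have r_inj: "r m = r n \<longleftrightarrow> m = n" for m n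
    using r by (auto simp: ray_def dest: injD)
  have cases3: "(\<exists>k. n = 3 * k) \<or> (\<exists>k. n = 3 * k + 1) \<or> (\<exists>k. n = 3 * k + 2)" for n :: nat
    by presburger
  have ij: "i (3 * k) = k" "j (3 * k) = k" "i (3 * k + 1) = k" "j (3 * k + 1) = Suc k"
    "i (3 * k + 2) = Suc k" "j (3 * k + 2) = k" "i (3 * k + 3) = Suc k" "j (3 * k + 3) = Suc k" for k
    unfolding i_def j_def by presburger+
  have R_eq: "R (3 * k) = (r k, r k)" "R (3 * k + 1) = (r k, r (Suc k))"
    "R (3 * k + 2) = (r (Suc k), r k)" "R (3 * k + 3) = (r (Suc k), r (Suc k))" for k
    unfolding R_def ij by (rule refl)+
  have "m = n" if "i m = i n" "j m = j n" for m n
    using cases3[of m] cases3[of n] that by (elim disjE exE) (simp_all only: ij)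
  then have "inj R"
    by (auto simp: R_def r_inj intro: injI)
  moreover have "R n \<in> verts (blowup G)" for n
    using cases3[of n] by (elim disjE exE) (simp_all only: R_eq in_verts_blowup r_verts r_adj simp_thms)
  moreover have "adj (blowup G) (R n) (R (Suc n))" for n
  proof -
    have Suc_eq: "Suc (3 * k) = 3 * k + 1" "Suc (3 * k + 1) = 3 * k + 2" "Suc (3 * k + 2) = 3 * k + 3" for k
      by simp_all
    show ?thesis
      using cases3[of n] unfolding adj_blowup blowup_adj_def
      by (elim disjE exE) (simp_all only: Suc_eq R_eq prod.case r_adj simp_thms)
  qed
  ultimately have R: "ray (blowup G) R"
    by (auto simp: ray_def)
  have "inseparable G r (\<lambda>n. fst (R n))"
  proof (rule inseparable_of_frequently)
    show "\<exists>m\<ge>N. \<exists>n\<ge>N. r m = fst (R n)" for N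
      by (rule exI[of _ N], intro conjI exI[of _ "3 * N"]) (simp_all add: R_eq)
  qed (use inseparable_refl[OF r] inseparable_project_refl[OF R] in simp_all)
  with R that show ?thesis
    by blast
qed

text \<open>In a clique the surviving vertices are adjacent to each other, so losing the centre does
  no harm; in a star they communicate through the centre, which must survive.\<close>

lemma reachable_within_blowup:
  assumes "(w, t) \<in> verts (blowup G) - S" "(w, t') \<in> verts (blowup G) - S"
    and "edge_dominating G w \<or> (w, w) \<notin> S"
  shows "(adj (del_verts (blowup G) S))\<^sup>*\<^sup>* (w, t) (w, t')"
proof (cases "t = t' \<or> t = w \<or> t' = w \<or> edge_dominating G w")
  case True
  then have "(w, t) = (w, t') \<or> adj (del_verts (blowup G) S) (w, t) (w, t')"
    using assms by (auto simp: adj_del_verts adj_blowup blowup_adj_def in_verts_blowup)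
  then show ?thesis
    by auto
next
  case False
  then have "adj (del_verts (blowup G) S) (w, t) (w, w)" "adj (del_verts (blowup G) S) (w, w) (w, t')"
    using assms by (auto simp: adj_del_verts adj_blowup blowup_adj_def in_verts_blowup)
  then show ?thesis
    by (meson converse_rtranclp_into_rtranclp r_into_rtranclp)
qed

text \<open>Each edge of the walk lifts to the edge joining its two half-edges, which survive
  because \<open>F\<close> contains every edge with a half-edge in \<open>S\<close>. Between
  consecutive edges the lift moves inside one star or clique. The condition on centres concerns only
  vertices reachable from \<open>v\<close>, since elsewhere a star may well have lost its
  centre.\<close>

lemma reachable_lift:
  assumes "(adj (del_edges G F))\<^sup>*\<^sup>* v w"
    and F: "\<And>u t. (u, t) \<in> S \<Longrightarrow> adj G u t \<Longrightarrow> {u, t} \<in> F"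
    and centres: "\<And>w. (adj (del_edges G F))\<^sup>*\<^sup>* v w \<Longrightarrow> w \<in> verts G \<Longrightarrow> edge_dominating G w \<or> (w, w) \<notin> S"
    and v: "(v, u) \<in> verts (blowup G) - S" and w: "(w, t) \<in> verts (blowup G) - S"
  shows "(adj (del_verts (blowup G) S))\<^sup>*\<^sup>* (v, u) (w, t)"
  using assms(1) w
proof (induction arbitrary: t)
  case base
  moreover have "edge_dominating G v \<or> (v, v) \<notin> S"
    using v by (intro centres) (auto simp: in_verts_blowup)
  ultimately show ?case
    using v by (intro reachable_within_blowup)
next
  case (step y z)
  have yz: "adj G y z" "adj G z y" "{y, z} \<notin> F" "{z, y} \<notin> F"
    using step.hyps(2) adj_commute[of G y z] by (auto simp: adj_del_edges insert_commute)
  then have vs: "(y, z) \<in> verts (blowup G) - S" "(z, y) \<in> verts (blowup G) - S"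
    using F adjD by (auto simp: in_verts_blowup)
  \<comment> \<open>The second coordinate is generalised in the induction so that the lift can end
    at the half-edge leading to \<open>z\<close>.\<close>
  have "(adj (del_verts (blowup G) S))\<^sup>*\<^sup>* (v, u) (y, z)"
    using step.IH vs(1) by blast
  also have "adj (del_verts (blowup G) S) (y, z) (z, y)"
    using yz vs by (auto simp: adj_del_verts adj_blowup blowup_adj_def)
  also have "(adj (del_verts (blowup G) S))\<^sup>*\<^sup>* (z, y) (z, t)"
  proof (rule reachable_within_blowup[OF vs(2) step.prems])
    have "(adj (del_edges G F))\<^sup>*\<^sup>* v z"
      using step.hyps by (rule rtranclp.rtrancl_into_rtrancl)
    then show "edge_dominating G z \<or> (z, z) \<notin> S"
      using adjD[OF yz(1)] centres by blast
  qed
  finally show ?case .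
qed

text \<open>Domination speaks of rays of \<open>G\<close>, while the projection of \<open>R\<close>
  may not be one. A tracking ray is inseparable from the projection, so if no finite
  \<open>F\<close> worked, \<open>v\<close> would dominate that ray.\<close>

lemma timid_separable:
  assumes R: "ray (blowup G) R" and v: "v \<in> verts G" and timid: "\<not> edge_dominating G v"
  shows "\<exists>F. finite F \<and> F \<subseteq> edges G \<and> \<not> tail_connected (del_edges G F) (\<lambda>_. v) (\<lambda>n. fst (R n))"
proof -
  obtain r where r: "ray G r" "inseparable G r (\<lambda>n. fst (R n))"
    using obtain_tracking_ray[OF R] by blast
  have "\<not> edge_dominates G v r"
    using r(1) timid by (auto simp: edge_dominating_def)
  then have "\<not> inseparable G (\<lambda>_. v) r"
    using edge_dominates_iff[OF r(1) v] by (simp add: inseparable_def)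
  then have "\<not> inseparable G (\<lambda>_. v) (\<lambda>n. fst (R n))"
    using r(2) by (meson inseparable_sym inseparable_trans)
  then show ?thesis
    by (auto simp: inseparable_def)
qed

text \<open>Converse of projection. The set \<open>F\<close> depends on \<open>R\<close> and
  \<open>S\<close> but is the same for all \<open>R'\<close>, which is what continuity of
  \<open>to_end\<close> requires.\<close>

lemma tail_connected_lift:
  assumes R: "ray (blowup G) R" and S: "finite S"
  shows "\<exists>F. finite F \<and> F \<subseteq> edges G \<and>
    (\<forall>R'. ray (blowup G) R' \<longrightarrow>
       tail_connected (del_edges G F) (\<lambda>n. fst (R n)) (\<lambda>n. fst (R' n)) \<longrightarrow>
       tail_connected (del_verts (blowup G) S) R R')"
proof -
  \<comment> \<open>The stars whose centre is deleted: the only places where a connection of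
    \<open>G\<close> may fail to lift although its edges survive.\<close>
  define D where "D = {v. (v, v) \<in> S \<and> v \<in> verts G \<and> \<not> edge_dominating G v}"
  have "D \<subseteq> fst ` S"
    by (force simp: D_def)
  then have "finite D"
    using S by (meson finite_imageI finite_subset)
  have "\<forall>v\<in>D. \<exists>F. finite F \<and> F \<subseteq> edges G \<and>
      \<not> tail_connected (del_edges G F) (\<lambda>_. v) (\<lambda>n. fst (R n))"
    using timid_separable[OF R] by (auto simp: D_def)
  then obtain Fs where Fs: "\<And>v. v \<in> D \<Longrightarrow> finite (Fs v)" "\<And>v. v \<in> D \<Longrightarrow> Fs v \<subseteq> edges G"
      "\<And>v. v \<in> D \<Longrightarrow> \<not> tail_connected (del_edges G (Fs v)) (\<lambda>_. v) (\<lambda>n. fst (R n))"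
    by metis
  \<comment> \<open>The first part handles deleted half-edges, and intersecting with
    \<open>edges G\<close> discards pairs in \<open>S\<close> that are not half-edges. The second
    part cuts every star in \<open>D\<close> off from the tail of \<open>R\<close>.\<close>
  define F where "F = ((\<lambda>(u, w). {u, w}) ` S \<inter> edges G) \<union> \<Union> (Fs ` D)"
  have "finite F" "F \<subseteq> edges G"
    using S \<open>finite D\<close> Fs by (auto simp: F_def)
  moreover have "tail_connected (del_verts (blowup G) S) R R'"
    if R': "ray (blowup G) R'"
      and con: "tail_connected (del_edges G F) (\<lambda>n. fst (R n)) (\<lambda>n. fst (R' n))" for R'
  proof -
    obtain N where N: "\<And>m n. m \<ge> N \<Longrightarrow> n \<ge> N \<Longrightarrow> (adj (del_edges G F))\<^sup>*\<^sup>* (fst (R m)) (fst (R' n))"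
      using con unfolding tail_connected_def by blast
    obtain K where K: "\<forall>n\<ge>K. R n \<notin> S"
      using ray_eventually_avoids[OF R S] by blast
    obtain L where L: "\<forall>n\<ge>L. R' n \<notin> S"
      using ray_eventually_avoids[OF R' S] by blast
    have "(adj (del_verts (blowup G) S))\<^sup>*\<^sup>* (R m) (R' n)" if "m \<ge> max N (max K L)" "n \<ge> max N (max K L)" for m n
    proof -
      have vs: "R m \<in> verts (blowup G) - S" "R' n \<in> verts (blowup G) - S"
        using R R' K L that by (auto simp: ray_def)
      have "edge_dominating G w \<or> (w, w) \<notin> S"
        if w: "(adj (del_edges G F))\<^sup>*\<^sup>* (fst (R m)) w" "w \<in> verts G" for w
      proof (rule ccontr)
        assume "\<not> ?thesis"
        then have "w \<in> D"
          using w by (simp add: D_def)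
        \<comment> \<open>The hypothesis relates \<open>R\<close> only to \<open>R'\<close>, so the
          connection goes from \<open>w\<close> back to \<open>R m\<close>, over to
          \<open>R'\<close> and then to \<open>R k\<close>.\<close>
        have "(adj (del_edges G F))\<^sup>*\<^sup>* w (fst (R k))" if "k \<ge> N" for k
          using w(1) N \<open>m \<ge> max N (max K L)\<close> that
          by (meson max.boundedE order_refl reachable_sym rtranclp_trans)
        then have "tail_connected (del_edges G F) (\<lambda>_. w) (\<lambda>n. fst (R n))"
          unfolding tail_connected_const by blast
        \<comment> \<open>\<open>Fs w\<close> is contained in \<open>F\<close>, so deleting only
          \<open>Fs w\<close> keeps the connection.\<close>
        then have "tail_connected (del_edges G (Fs w)) (\<lambda>_. w) (\<lambda>n. fst (R n))"
          by (rule tail_connected_map[where f = "\<lambda>x. x"])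
            (use \<open>w \<in> D\<close> in \<open>auto simp: adj_del_edges F_def\<close>)
        then show False
          using Fs(3)[OF \<open>w \<in> D\<close>] by blast
      qed
      then have "(adj (del_verts (blowup G) S))\<^sup>*\<^sup>* (fst (R m), snd (R m)) (fst (R' n), snd (R' n))"
        using vs N that
        by (intro reachable_lift[where F = F]) (auto simp: F_def adj_def)
      then show ?thesis
        by simp
    qed
    then show ?thesis
      unfolding tail_connected_def by blast
  qed
  ultimately show ?thesis
    by blast
qed

lemma vert_inseparable_lift:
  assumes R: "ray (blowup G) R" and R': "ray (blowup G) R'"
    and insep: "inseparable G (\<lambda>n. fst (R n)) (\<lambda>n. fst (R' n))"
  shows "vert_inseparable (blowup G) R R'"
  unfolding vert_inseparable_def
proof (intro allI impI)
  fix S assume "finite S \<and> S \<subseteq> verts (blowup G)"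
  then show "tail_connected (del_verts (blowup G) S) R R'"
    using tail_connected_lift[OF R, of S] R' insep unfolding inseparable_def by blast
qed

text \<open>Both projected rays are inseparable from the constant sequence at \<open>fst x\<close>,
  hence from each other. Lifting then shows that no finite set of vertices separates the two
  rays.\<close>

lemma edge_dominated_end_unique:
  assumes x: "x \<in> verts (blowup G)"
    and \<omega>: "\<omega> \<in> ends (blowup G)" "edge_dominates_end (blowup G) x \<omega>"
    and \<omega>': "\<omega>' \<in> ends (blowup G)" "edge_dominates_end (blowup G) x \<omega>'"
  shows "\<omega> = \<omega>'"
proof -
  have ray: "ray (blowup G) R" if "R \<in> \<eta>" "\<eta> \<in> ends (blowup G)" for R \<eta>
    using that by (auto simp: ends_eq end_rel_iff)
  obtain R R' where R: "R \<in> \<omega>" "edge_dominates (blowup G) x R"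
      and R': "R' \<in> \<omega>'" "edge_dominates (blowup G) x R'"
    using \<omega>(2) \<omega>'(2) by (auto simp: edge_dominates_end_def)
  have rays: "ray (blowup G) R" "ray (blowup G) R'"
    using R(1) R'(1) \<omega>(1) \<omega>'(1) ray by blast+
  have "inseparable G (\<lambda>n. fst (R n)) (\<lambda>n. fst (R' n))"
    using edge_dominates_project[OF rays(1) x R(2)] edge_dominates_project[OF rays(2) x R'(2)]
    by (meson inseparable_sym inseparable_trans)
  then have "(R, R') \<in> end_rel (blowup G)"
    using rays vert_inseparable_lift by (simp add: end_rel_iff)
  then show ?thesis
    using quotient_eqI[OF equiv_end_rel, of \<omega> "blowup G" \<omega>' R R'] \<omega>(1) \<omega>'(1) R(1) R'(1)
    by (simp add: ends_def)
qed

section \<open>The mutually inverse maps between the two end spaces\<close>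

definition to_edge_end :: "(nat \<Rightarrow> 'a \<times> 'a) set \<Rightarrow> (nat \<Rightarrow> 'a) set" where
  "to_edge_end \<omega> = {r. ray G r \<and> (\<exists>R\<in>\<omega>. inseparable G r (\<lambda>n. fst (R n)))}"

definition to_end :: "(nat \<Rightarrow> 'a) set \<Rightarrow> (nat \<Rightarrow> 'a \<times> 'a) set" where
  "to_end \<eta> = {R. ray (blowup G) R \<and> (\<exists>r\<in>\<eta>. inseparable G r (\<lambda>n. fst (R n)))}"

text \<open>The map is defined without choosing representatives; any matching pair \<open>R\<close>,
  \<open>r\<close> computes it. Independence of the representative \<open>R\<close> comes from
  projecting inseparability.\<close>

lemma to_edge_end_eq:
  assumes "ray G r" "ray (blowup G) R" "inseparable G r (\<lambda>n. fst (R n))"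
  shows "to_edge_end (end_rel (blowup G) `` {R}) = edge_end_rel G `` {r}"
proof (intro set_eqI iffI)
  fix s assume "s \<in> to_edge_end (end_rel (blowup G) `` {R})"
  then obtain R' where R': "ray G s" "inseparable G s (\<lambda>n. fst (R' n))" "vert_inseparable (blowup G) R R'"
    by (auto simp: to_edge_end_def end_rel_iff)
  note assms(3)
  also note inseparable_project[OF R'(3)]
  also note inseparable_sym[OF R'(2)]
  finally show "s \<in> edge_end_rel G `` {r}"
    using assms(1) R'(1) by (simp add: edge_end_rel_iff)
next
  fix s assume "s \<in> edge_end_rel G `` {r}"
  then have s: "ray G s" "inseparable G s r"
    using inseparable_sym by (auto simp: edge_end_rel_iff)
  then have "inseparable G s (\<lambda>n. fst (R n))"
    using assms(3) inseparable_trans by metis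
  then show "s \<in> to_edge_end (end_rel (blowup G) `` {R})"
    using s(1) assms(2) by (auto simp: to_edge_end_def end_rel_iff vert_inseparable_refl)
qed

text \<open>Here the inclusion into a single end needs the harder direction, lifting inseparability
  from \<open>G\<close> to the blown-up graph.\<close>

lemma to_end_eq:
  assumes "ray G r" "ray (blowup G) R" "inseparable G r (\<lambda>n. fst (R n))"
  shows "to_end (edge_end_rel G `` {r}) = end_rel (blowup G) `` {R}"
proof (intro set_eqI iffI)
  fix R' assume "R' \<in> to_end (edge_end_rel G `` {r})"
  then obtain s where R': "ray (blowup G) R'" "inseparable G r s" "inseparable G s (\<lambda>n. fst (R' n))"
    by (auto simp: to_end_def edge_end_rel_iff)
  note inseparable_sym[OF assms(3)]
  also note R'(2)
  also note R'(3)
  finally show "R' \<in> end_rel (blowup G) `` {R}"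
    using assms(2) R'(1) vert_inseparable_lift by (simp add: end_rel_iff)
next
  fix R' assume "R' \<in> end_rel (blowup G) `` {R}"
  then have R': "ray (blowup G) R'" "vert_inseparable (blowup G) R R'"
    by (auto simp: end_rel_iff)
  then have "inseparable G r (\<lambda>n. fst (R' n))"
    using assms(3) inseparable_trans inseparable_project by metis
  then show "R' \<in> to_end (edge_end_rel G `` {r})"
    using R'(1) assms(1) by (auto simp: to_end_def edge_end_rel_iff inseparable_refl)
qed

lemma end_cases:
  assumes "\<omega> \<in> ends (blowup G)"
  obtains R r where "ray (blowup G) R" "ray G r" "inseparable G r (\<lambda>n. fst (R n))"
    "\<omega> = end_rel (blowup G) `` {R}" "to_edge_end \<omega> = edge_end_rel G `` {r}"
proof -
  obtain R where R: "ray (blowup G) R" "\<omega> = end_rel (blowup G) `` {R}"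
    using assms unfolding ends_eq mem_Collect_eq by (elim exE conjE)
  then obtain r where "ray G r" "inseparable G r (\<lambda>n. fst (R n))"
    using obtain_tracking_ray by metis
  then show ?thesis
    using that R to_edge_end_eq by metis
qed

lemma edge_end_cases:
  assumes "\<eta> \<in> edge_ends G"
  obtains R r where "ray (blowup G) R" "ray G r" "inseparable G r (\<lambda>n. fst (R n))"
    "\<eta> = edge_end_rel G `` {r}" "to_end \<eta> = end_rel (blowup G) `` {R}"
proof -
  obtain r where r: "ray G r" "\<eta> = edge_end_rel G `` {r}"
    using assms unfolding edge_ends_eq mem_Collect_eq by (elim exE conjE)
  then obtain R where "ray (blowup G) R" "inseparable G r (\<lambda>n. fst (R n))"
    using obtain_lifted_ray by metis
  then show ?thesis
    using that r to_end_eq by metis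
qed

lemma to_edge_end_in: "to_edge_end \<in> ends (blowup G) \<rightarrow> edge_ends G"
  by (rule Pi_I, erule end_cases) (auto simp: edge_ends_eq)

lemma to_end_in: "to_end \<in> edge_ends G \<rightarrow> ends (blowup G)"
  by (rule Pi_I, erule edge_end_cases) (auto simp: ends_eq)

text \<open>For a finite \<open>F\<close>, the set \<open>half_edges F\<close> cuts out the required
  neighbourhood: rays it does not separate have projections that \<open>F\<close> does not separate,
  and the tracking rays are inseparable from these projections.\<close>

lemma continuous_map_to_edge_end:
  "continuous_map (end_space (blowup G)) (edge_end_space G) to_edge_end"
proof (rule continuous_map_to_edge_end_spaceI)
  show "to_edge_end \<in> topspace (end_space (blowup G)) \<rightarrow> edge_ends G"
    using to_edge_end_in by (simp add: topspace_end_space)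
next
  fix \<omega> F s
  assume "\<omega> \<in> topspace (end_space (blowup G))" and F: "finite F" "F \<subseteq> edges G"
    and s: "ray G s" "to_edge_end \<omega> = edge_end_rel G `` {s}"
  then obtain R r where R: "ray (blowup G) R" "ray G r" "inseparable G r (\<lambda>n. fst (R n))"
    "\<omega> = end_rel (blowup G) `` {R}" "to_edge_end \<omega> = edge_end_rel G `` {r}"
    using end_cases by (metis topspace_end_space)
  have "(s, r) \<in> edge_end_rel G"
    using s R(2,5) by (metis Image_singleton_iff edge_end_rel_iff inseparable_refl)
  then have sr: "inseparable G s r"
    by (simp add: edge_end_rel_iff)
  note H = finite_half_edges[OF F]
  have "to_edge_end \<omega>' \<in> edge_end_nbhd G F s" if \<omega>': "\<omega>' \<in> end_nbhd (blowup G) (half_edges F) R" for \<omega>'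
  proof -
    have "\<omega>' \<in> ends (blowup G)"
      using openin_subset[OF openin_end_nbhd[OF R(1) H]] \<omega>' by (auto simp: topspace_end_space)
    then obtain R' r' where R': "ray (blowup G) R'" "ray G r'" "inseparable G r' (\<lambda>n. fst (R' n))"
      "\<omega>' = end_rel (blowup G) `` {R'}" "to_edge_end \<omega>' = edge_end_rel G `` {r'}"
      using end_cases by metis
    have "tail_connected (del_edges G F) s r"
      using sr F by (simp add: inseparable_def)
    also have "tail_connected (del_edges G F) r (\<lambda>n. fst (R n))"
      using R(3) F by (simp add: inseparable_def)
    also have "tail_connected (del_edges G F) (\<lambda>n. fst (R n)) (\<lambda>n. fst (R' n))"
      using \<omega>' end_in_nbhd_iff[OF R(1) R'(1) H] R'(4) by (intro tail_connected_project) simp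
    also have "tail_connected (del_edges G F) (\<lambda>n. fst (R' n)) r'"
      using inseparable_sym[OF R'(3)] F by (simp add: inseparable_def)
    finally show ?thesis
      using edge_end_in_nbhd_iff[OF s(1) R'(2) F] R'(5) by simp
  qed
  moreover have "openin (end_space (blowup G)) (end_nbhd (blowup G) (half_edges F) R)"
    using openin_end_nbhd[OF R(1) H] .
  moreover have "\<omega> \<in> end_nbhd (blowup G) (half_edges F) R"
    using end_nbhd_self[OF R(1) H] R(4) by simp
  ultimately show "\<exists>T. openin (end_space (blowup G)) T \<and> \<omega> \<in> T \<and> to_edge_end ` T \<subseteq> edge_end_nbhd G F s"
    by (meson image_subsetI)
qed

text \<open>For a finite \<open>S\<close>, the required neighbourhood comes from the set
  \<open>F\<close> of \<open>tail_connected_lift\<close> for a lift \<open>R\<close> of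
  \<open>r\<close>. As \<open>F\<close> works for all \<open>R'\<close> at once, every edge-end in
  it is mapped into the given neighbourhood.\<close>

lemma continuous_map_to_end:
  "continuous_map (edge_end_space G) (end_space (blowup G)) to_end"
proof (rule continuous_map_to_end_spaceI)
  show "to_end \<in> topspace (edge_end_space G) \<rightarrow> ends (blowup G)"
    using to_end_in by (simp add: topspace_edge_end_space)
next
  fix \<eta> S Q
  assume "\<eta> \<in> topspace (edge_end_space G)" and S: "finite S" "S \<subseteq> verts (blowup G)"
    and Q: "ray (blowup G) Q" "to_end \<eta> = end_rel (blowup G) `` {Q}"
  then obtain R r where R: "ray (blowup G) R" "ray G r" "inseparable G r (\<lambda>n. fst (R n))"
    "\<eta> = edge_end_rel G `` {r}" "to_end \<eta> = end_rel (blowup G) `` {R}"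
    using edge_end_cases by (metis topspace_edge_end_space)
  have "(Q, R) \<in> end_rel (blowup G)"
    using Q R(1,5) by (metis Image_singleton_iff end_rel_iff vert_inseparable_refl)
  then have QR: "tail_connected (del_verts (blowup G) S) Q R"
    using S by (simp add: end_rel_iff vert_inseparable_def)
  obtain F where F: "finite F" "F \<subseteq> edges G"
    and lift: "\<And>R'. ray (blowup G) R' \<Longrightarrow>
      tail_connected (del_edges G F) (\<lambda>n. fst (R n)) (\<lambda>n. fst (R' n)) \<Longrightarrow>
      tail_connected (del_verts (blowup G) S) R R'"
    using tail_connected_lift[OF R(1) S(1)] by blast
  have "to_end \<eta>' \<in> end_nbhd (blowup G) S Q" if \<eta>': "\<eta>' \<in> edge_end_nbhd G F r" for \<eta>'
  proof -
    have "\<eta>' \<in> edge_ends G"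
      using openin_subset[OF openin_edge_end_nbhd[OF R(2) F]] \<eta>' by (auto simp: topspace_edge_end_space)
    then obtain R' r' where R': "ray (blowup G) R'" "ray G r'" "inseparable G r' (\<lambda>n. fst (R' n))"
      "\<eta>' = edge_end_rel G `` {r'}" "to_end \<eta>' = end_rel (blowup G) `` {R'}"
      using edge_end_cases by metis
    have "tail_connected (del_edges G F) (\<lambda>n. fst (R n)) r"
      using inseparable_sym[OF R(3)] F by (simp add: inseparable_def)
    also have "tail_connected (del_edges G F) r r'"
      using \<eta>' edge_end_in_nbhd_iff[OF R(2) R'(2) F] R'(4) by simp
    also have "tail_connected (del_edges G F) r' (\<lambda>n. fst (R' n))"
      using R'(3) F by (simp add: inseparable_def)
    finally have "tail_connected (del_verts (blowup G) S) R R'"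
      using lift R'(1) by blast
    with QR have "tail_connected (del_verts (blowup G) S) Q R'"
      by (rule tail_connected_trans)
    then show ?thesis
      using end_in_nbhd_iff[OF Q(1) R'(1) S] R'(5) by simp
  qed
  moreover have "openin (edge_end_space G) (edge_end_nbhd G F r)"
    using openin_edge_end_nbhd[OF R(2) F] .
  moreover have "\<eta> \<in> edge_end_nbhd G F r"
    using edge_end_nbhd_self[OF R(2) F] R(4) by simp
  ultimately show "\<exists>T. openin (edge_end_space G) T \<and> \<eta> \<in> T \<and> to_end ` T \<subseteq> end_nbhd (blowup G) S Q"
    by (meson image_subsetI)
qed

lemma end_space_blowup: "end_space (blowup G) homeomorphic_space edge_end_space G"
proof -
  have "to_end (to_edge_end \<omega>) = \<omega>" if "\<omega> \<in> ends (blowup G)" for \<omega>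
    using that by (rule end_cases) (metis to_end_eq)
  moreover have "to_edge_end (to_end \<eta>) = \<eta>" if "\<eta> \<in> edge_ends G" for \<eta>
    using that by (rule edge_end_cases) (metis to_edge_end_eq)
  ultimately have "homeomorphic_maps (end_space (blowup G)) (edge_end_space G) to_edge_end to_end"
    unfolding homeomorphic_maps_def topspace_end_space topspace_edge_end_space
    using continuous_map_to_edge_end continuous_map_to_end by blast
  then show ?thesis
    unfolding homeomorphic_space_def by blast
qed

end

theorem theorem2p1:
  fixes G :: "'a ugraph"
  assumes "simple_graph G"
  shows "\<exists>H :: ('a \<times> 'a) ugraph. simple_graph H \<and>
           (\<forall>v\<in>verts H. \<exists>\<^sub>\<le>\<^sub>1 \<omega>. \<omega> \<in> ends H \<and> edge_dominates_end H v \<omega>) \<and>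
           end_space H homeomorphic_space edge_end_space G"
proof (intro exI[of _ "blowup G"] conjI ballI)
  show "simple_graph (blowup G)"
    using assms by (rule simple_graph_blowup)
  show "\<exists>\<^sub>\<le>\<^sub>1 \<omega>. \<omega> \<in> ends (blowup G) \<and> edge_dominates_end (blowup G) v \<omega>"
    if "v \<in> verts (blowup G)" for v
    using edge_dominated_end_unique[OF assms that] by (auto intro: Uniq_I)
  show "end_space (blowup G) homeomorphic_space edge_end_space G"
    using assms by (rule end_space_blowup)
qed

end
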